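(* Let $n\ge 1$, let $a=v_0<v_1<\dots<v_n=b$, let $\zeta_i\in(v_i,v_{i+1})$ for $0\le i\le n-1$, and let $\varphi(i)\ge 1$ be integers for $0\le i\le n$. For any real values $f_{i,j}$, $0\le i\le n$, $0\le j\le \varphi(i)-1$, there exists a unique spline $s\in\mathcal{S}^1(\varphi,\overline{\tau}_n)$ such that $$s^{(j)}(v_i)=f_{i,j},\qquad 0\le i\le n,\ 0\le j\le \varphi(i)-1.$$
   Context: $\tau_n=\{v_0,\dots,v_n\}$ is a partition of $[a,b]$, $\zeta=\{\zeta_0,\dots,\zeta_{n-1}\}$ is the set of split points, and $\overline{\tau}_n=\tau_n\cup\zeta$ is the refined partition. Put $\zeta_{-1}=v_0$ and $\zeta_n=v_n$. $\mathbb{P}_d$ is the space of real polynomials of degree $\le d$. The space $\mathcal{S}^1(\varphi,\overline{\tau}_n)$ consists of all functions $s:[a,b]\to\mathbb{R}$ such that: (i) for each $0\le i\le n$, the restrictions of $s$ to $[\zeta_{i-1},v_i]$ and to $[v_i,\zeta_i]$ (when these intervals are non-degenerate) are polynomials in $\mathbb{P}_{\varphi(i)}$; (ii) $s$ is $\mathcal{C}^{\varphi(i)-1}$ at $v_i$ for $0<i<n$; (iii) $s$ is $\mathcal{C}^1$ at $\zeta_i$ for $0\le i\le n-1$. Here "$\mathcal{C}^r$ at a point" means that the derivatives of orders $0,\dots,r$ of the two adjacent polynomial pieces agree at that point. Derivatives at $v_0$ and $v_n$ are one-sided. *)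

theory Defs
  imports "HOL-Analysis.Analysis" "HOL-Computational_Algebra.Polynomial"
begin

definition poly_on :: "nat \<Rightarrow> real set \<Rightarrow> (real \<Rightarrow> real) \<Rightarrow> bool" where
  "poly_on d I s \<longleftrightarrow> (\<exists>p :: real poly. degree p \<le> d \<and> (\<forall>x\<in>I. s x = poly p x))"

(* Only used with l < x < u, so the two polynomials are determined by s. *)
definition pieces_agree :: "nat \<Rightarrow> real \<Rightarrow> real \<Rightarrow> real \<Rightarrow> (real \<Rightarrow> real) \<Rightarrow> bool" where
  "pieces_agree r l x u s \<longleftrightarrow>
     (\<exists>p q :: real poly.
        (\<forall>y\<in>{l..x}. s y = poly p y) \<and>
        (\<forall>y\<in>{x..u}. s y = poly q y) \<and>
        (\<forall>k\<le>r. poly ((pderiv ^^ k) p) x = poly ((pderiv ^^ k) q) x))"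

(* split_left v z i and split_right n v z i are the split points z_(i-1) and z_i,
   with the conventions z_(-1) = v_0 and z_n = v_n. *)
definition split_left :: "(nat \<Rightarrow> real) \<Rightarrow> (nat \<Rightarrow> real) \<Rightarrow> nat \<Rightarrow> real" where
  "split_left v z i = (if i = 0 then v 0 else z (i - 1))"

definition split_right :: "nat \<Rightarrow> (nat \<Rightarrow> real) \<Rightarrow> (nat \<Rightarrow> real) \<Rightarrow> nat \<Rightarrow> real" where
  "split_right n v z i = (if i = n then v n else z i)"

(* A function on [v_0, v_n] is a total function that is undefined outside this
   interval, so that equality of splines is equality on the interval. *)
definition spline_space ::
  "nat \<Rightarrow> (nat \<Rightarrow> real) \<Rightarrow> (nat \<Rightarrow> real) \<Rightarrow> (nat \<Rightarrow> nat) \<Rightarrow> (real \<Rightarrow> real) set" where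
  "spline_space n v z \<phi> =
     {s \<in> extensional {v 0..v n}.
        (\<forall>i\<le>n.
           (split_left v z i < v i \<longrightarrow> poly_on (\<phi> i) {split_left v z i..v i} s) \<and>
           (v i < split_right n v z i \<longrightarrow> poly_on (\<phi> i) {v i..split_right n v z i} s)) \<and>
        (\<forall>i. 0 < i \<and> i < n \<longrightarrow>
           pieces_agree (\<phi> i - 1) (split_left v z i) (v i) (split_right n v z i) s) \<and>
        (\<forall>i<n. pieces_agree 1 (v i) (z i) (v (Suc i)) s)}"

(* Differentiating within the domain makes the derivatives one-sided at its end points. *)
primrec deriv_within :: "real set \<Rightarrow> nat \<Rightarrow> (real \<Rightarrow> real) \<Rightarrow> real \<Rightarrow> real" where
  "deriv_within I 0 s = s"
| "deriv_within I (Suc j) s = (\<lambda>x. vector_derivative (deriv_within I j s) (at x within I))"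

end

theory Submission
  imports Defs
begin

text \<open>
  On each interval \<open>[v\<^sub>i, v\<^sub>i\<^sub>+\<^sub>1]\<close> the interpolation conditions fix the two pieces \<open>p\<close>, \<open>q\<close> up to
  adding multiples \<open>c (x - v\<^sub>i)\<^sup>d\<close> and \<open>c' (x - v\<^sub>i\<^sub>+\<^sub>1)\<^sup>e\<close>, where \<open>d = \<phi> i\<close> and \<open>e = \<phi> (i + 1)\<close>. The two
  smoothness conditions at the split point form a linear system in \<open>c\<close> and \<open>c'\<close> whose determinant is,
  up to a nonzero factor, \<open>h e + k d\<close> with \<open>h\<close> and \<open>k\<close> the distances from the split point to the
  neighbouring knots. So both pieces are determined interval by interval, and smoothness at the
  knots is automatic because neighbouring pieces share the interpolated derivatives.
\<close>

subsection \<open>Polynomials with prescribed derivatives at a point\<close>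

lemma higher_pderiv_pcompose_shift:
  fixes p :: "'a :: idom poly"
  shows "(pderiv ^^ j) (pcompose p [:c, 1:]) = pcompose ((pderiv ^^ j) p) [:c, 1:]"
  by (induction j) (simp_all add: pderiv_pcompose pderiv_pCons)

lemma pcompose_shift_inverse:
  fixes p :: "'a :: comm_ring_1 poly"
  shows "pcompose (pcompose p [:x, 1:]) [:-x, 1:] = p"
  by (simp add: pcompose_assoc[symmetric] pcompose_pCons)

lemma poly_higher_pderiv_0:
  fixes p :: "'a :: {comm_semiring_1, semiring_no_zero_divisors, semiring_char_0} poly"
  shows "poly ((pderiv ^^ j) p) 0 = fact j * coeff p j"
  by (simp add: poly_0_coeff_0 coeff_higher_pderiv pochhammer_fact)

lemma higher_pderiv_diff:
  fixes p q :: "'a :: idom poly"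
  shows "(pderiv ^^ j) (p - q) = (pderiv ^^ j) p - (pderiv ^^ j) q"
  by (induction j) (simp_all add: pderiv_diff)

lemma pcompose_monom_shift:
  fixes x :: "'a :: comm_ring_1"
  shows "pcompose (monom c d) [:-x, 1:] = smult c ([:-x, 1:] ^ d)"
  by (induction d) (simp_all add: monom_0 monom_Suc pcompose_pCons one_pCons)

lemma degree_pcompose_shift:
  fixes p :: "'a :: idom poly"
  shows "degree (pcompose p [:c, 1:]) = degree p"
  by (simp add: degree_pcompose)

lemma taylor_poly_exists:
  fixes x :: real
  obtains p where "degree p \<le> d" and "\<And>j. j \<le> d \<Longrightarrow> poly ((pderiv ^^ j) p) x = g j"
proof
  \<comment> \<open>These are Taylor coefficients at 0; composing with \<open>[:-x, 1:]\<close>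
    moves the expansion point to \<open>x\<close>.\<close>
  define P where "P = (\<Sum>i\<le>d. monom (g i / fact i) i)"
  show "degree (pcompose P [:-x, 1:]) \<le> d"
    unfolding degree_pcompose_shift P_def
    by (intro degree_sum_le) (auto intro: order_trans[OF degree_monom_le])
  show "poly ((pderiv ^^ j) (pcompose P [:-x, 1:])) x = g j" if "j \<le> d" for j
  proof -
    have "coeff P j = g j / fact j"
      using that by (simp add: P_def coeff_sum)
    then show ?thesis
      by (simp add: higher_pderiv_pcompose_shift poly_pcompose poly_higher_pderiv_0)
  qed
qed

text \<open>Translating \<open>x\<close> to 0 turns derivatives into multiples of coefficients. The
  vanishing conditions kill those below \<open>d\<close>, the degree bound those above.\<close>

lemma vanishing_derivatives_imp_monomial:
  fixes x :: real
  assumes "degree p \<le> d" and "\<And>j. j < d \<Longrightarrow> poly ((pderiv ^^ j) p) x = 0"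
  obtains c where "p = smult c ([:-x, 1:] ^ d)"
proof
  define P where "P = pcompose p [:x, 1:]"
  have "coeff P j = 0" if "j < d" for j
    using assms(2)[OF that] poly_higher_pderiv_0[of j P]
    by (simp add: P_def higher_pderiv_pcompose_shift poly_pcompose)
  moreover have "coeff P j = 0" if "j > d" for j
    using that assms(1) by (intro coeff_eq_0) (simp add: P_def degree_pcompose_shift)
  ultimately have "P = monom (coeff P d) d"
    by (intro poly_eqI) (metis coeff_monom linorder_neqE_nat)
  then have "pcompose P [:-x, 1:] = smult (coeff P d) ([:-x, 1:] ^ d)"
    using pcompose_monom_shift by metis
  then show "p = smult (coeff P d) ([:-x, 1:] ^ d)"
    by (simp add: P_def pcompose_shift_inverse)
qed

lemma poly_higher_pderiv_shifted_power:
  fixes x :: real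
  assumes "j < d"
  shows "poly ((pderiv ^^ j) (smult c ([:-x, 1:] ^ d))) x = 0"
  using assms unfolding pcompose_monom_shift[symmetric]
  by (simp add: higher_pderiv_pcompose_shift poly_pcompose poly_higher_pderiv_0)

text \<open>\<open>poly_on\<close> and \<open>pieces_agree\<close> each supply their own
  polynomials; this identifies those that represent the same piece, since a nonzero difference has
  finitely many roots.\<close>

lemma poly_eq_if_eq_on_interval:
  fixes p q :: "real poly"
  assumes "l < u" and "\<And>y. y \<in> {l..u} \<Longrightarrow> poly p y = poly q y"
  shows "p = q"
proof (rule ccontr)
  assume "p \<noteq> q"
  then have "finite {y. poly (p - q) y = 0}"
    by (intro poly_roots_finite) simp
  moreover have "{l..u} \<subseteq> {y. poly (p - q) y = 0}"
    using assms(2) by auto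
  ultimately show False
    using infinite_Icc[OF assms(1)] finite_subset by blast
qed

subsection \<open>Two pieces joined at a split point\<close>

text \<open>The offsets of the split point from the two knots, \<open>h\<close> and
  \<open>-k\<close>, have opposite signs. Hence the two terms of the determinant have equal sign and
  cannot cancel.\<close>

lemma split_system_solvable:
  fixes h k \<alpha> \<beta> :: real
  assumes "h > 0" "k > 0" "d \<ge> 1" "e \<ge> 1"
  obtains c c' where "c * h ^ d - c' * (-k) ^ e = \<alpha>"
    and "c * (real d * h ^ (d - 1)) - c' * (real e * (-k) ^ (e - 1)) = \<beta>"
proof -
  \<comment> \<open>Cramer's rule in the rescaled unknowns \<open>X = c * h ^ (d - 1)\<close> and
    \<open>Y = c' * (-k) ^ (e - 1)\<close>, for which the system reads
    \<open>X * h + Y * k = \<alpha>\<close> and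
    \<open>X * real d - Y * real e = \<beta>\<close>.\<close>
  define D where "D = h * real e + k * real d"
  define X where "X = (\<alpha> * real e + \<beta> * k) / D"
  define Y where "Y = (\<alpha> * real d - \<beta> * h) / D"
  have "D > 0"
    using assms by (simp add: D_def add_pos_pos)
  have "X * h + Y * k = \<alpha> * D / D"
    by (simp add: X_def Y_def D_def add_divide_distrib[symmetric] algebra_simps)
  then have 1: "X * h + Y * k = \<alpha>"
    using \<open>D > 0\<close> by simp
  have "X * real d - Y * real e = \<beta> * D / D"
    by (simp add: X_def Y_def D_def diff_divide_distrib[symmetric] algebra_simps)
  then have 2: "X * real d - Y * real e = \<beta>"
    using \<open>D > 0\<close> by simp
  obtain d' e' where de: "d = Suc d'" "e = Suc e'"
    using assms by (metis Suc_le_D One_nat_def)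
  show ?thesis
  proof
    show "X / h ^ (d - 1) * h ^ d - Y / (-k) ^ (e - 1) * (-k) ^ e = \<alpha>"
      using 1 assms by (simp add: de)
    show "X / h ^ (d - 1) * (real d * h ^ (d - 1)) -
        Y / (-k) ^ (e - 1) * (real e * (-k) ^ (e - 1)) = \<beta>"
      using 2 assms by (simp add: de)
  qed
qed

lemma split_system_trivial_kernel:
  fixes h k :: real
  assumes "h > 0" "k > 0" "d \<ge> 1" "e \<ge> 1"
    and 1: "c * h ^ d = c' * (-k) ^ e"
    and 2: "c * (real d * h ^ (d - 1)) = c' * (real e * (-k) ^ (e - 1))"
  shows "c = 0 \<and> c' = 0"
proof -
  obtain d' e' where de: "d = Suc d'" "e = Suc e'"
    using assms by (metis Suc_le_D One_nat_def)
  define X where "X = c * h ^ d'"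
  define Y where "Y = c' * (-k) ^ e'"
  have 1: "X * h = - Y * k"
    using 1 by (simp add: X_def Y_def de mult_ac)
  have 2: "X * real d = Y * real e"
    using 2 by (simp add: X_def Y_def de mult_ac)
  \<comment> \<open>Adding \<open>real e\<close> times the first equation to \<open>k\<close> times
    the second eliminates \<open>Y\<close>.\<close>
  have "X * (h * real e + k * real d) = (X * h) * real e + k * (X * real d)"
    by (simp add: algebra_simps)
  also have "\<dots> = 0"
    unfolding 1 2 by (simp add: algebra_simps)
  finally have "X = 0"
    using assms by (simp add: add_pos_pos less_imp_neq[symmetric])
  then have "Y = 0"
    using 2 assms by simp
  then show ?thesis
    using \<open>X = 0\<close> assms by (simp add: X_def Y_def)
qed

text \<open>The local problem on one knot interval, stated for polynomials alone. It imposes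
  \<open>d + e + 2\<close> linear conditions on as many coefficients.\<close>

definition hermite_pair ::
  "nat \<Rightarrow> nat \<Rightarrow> real \<Rightarrow> real \<Rightarrow> real \<Rightarrow> (nat \<Rightarrow> real) \<Rightarrow> (nat \<Rightarrow> real) \<Rightarrow> real poly \<Rightarrow> real poly \<Rightarrow> bool"
  where "hermite_pair d e x z y g g' p q \<longleftrightarrow>
    degree p \<le> d \<and> degree q \<le> e \<and>
    (\<forall>j<d. poly ((pderiv ^^ j) p) x = g j) \<and>
    (\<forall>j<e. poly ((pderiv ^^ j) q) y = g' j) \<and>
    poly p z = poly q z \<and> poly (pderiv p) z = poly (pderiv q) z"

lemma poly_pderiv_shifted_power:
  fixes x z :: real
  shows "poly (pderiv ([:-x, 1:] ^ d)) z = real d * (z - x) ^ (d - 1)"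
proof (cases d)
  case (Suc m)
  have "poly (pderiv ([:-x, 1:] ^ Suc m)) z = real (Suc m) * (z - x) ^ m"
    unfolding pderiv_power_Suc by (simp add: pderiv_pCons algebra_simps)
  then show ?thesis
    using Suc by simp
qed simp

lemma hermite_pair_exists:
  assumes "x < z" "z < y" "d \<ge> 1" "e \<ge> 1"
  obtains p q where "hermite_pair d e x z y g g' p q"
proof -
  \<comment> \<open>Only the orders below \<open>d\<close> matter here: the order \<open>d\<close>
    value of \<open>p0\<close> is arbitrary, and the multiple of \<open>[:-x, 1:] ^ d\<close>
    corrects it. The same holds for \<open>q0\<close> and \<open>e\<close>.\<close>
  obtain p0 where p0: "degree p0 \<le> d" "\<And>j. j \<le> d \<Longrightarrow> poly ((pderiv ^^ j) p0) x = g j"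
    using taylor_poly_exists by blast
  obtain q0 where q0: "degree q0 \<le> e" "\<And>j. j \<le> e \<Longrightarrow> poly ((pderiv ^^ j) q0) y = g' j"
    using taylor_poly_exists by blast
  \<comment> \<open>The right-hand sides are the jumps of value and slope at \<open>z\<close> that
    the corrections must cancel.\<close>
  obtain c c' where c:
    "c * (z - x) ^ d - c' * (-(y - z)) ^ e = poly q0 z - poly p0 z"
    "c * (real d * (z - x) ^ (d - 1)) - c' * (real e * (-(y - z)) ^ (e - 1)) =
       poly (pderiv q0) z - poly (pderiv p0) z"
    by (rule split_system_solvable[of "z - x" "y - z" d e]) (use assms in auto)
  have "hermite_pair d e x z y g g'
    (p0 + smult c ([:-x, 1:] ^ d)) (q0 + smult c' ([:-y, 1:] ^ e))"
    unfolding hermite_pair_def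
  proof (intro conjI allI impI)
    show "degree (p0 + smult c ([:-x, 1:] ^ d)) \<le> d" "degree (q0 + smult c' ([:-y, 1:] ^ e)) \<le> e"
      using p0 q0 by (auto intro!: degree_add_le order_trans[OF degree_smult_le]
          simp: degree_linear_power)
    show "poly ((pderiv ^^ j) (p0 + smult c ([:-x, 1:] ^ d))) x = g j" if "j < d" for j
      using that p0 poly_higher_pderiv_shifted_power[OF that, of c x]
      by (simp add: higher_pderiv_add)
    show "poly ((pderiv ^^ j) (q0 + smult c' ([:-y, 1:] ^ e))) y = g' j" if "j < e" for j
      using that q0 poly_higher_pderiv_shifted_power[OF that, of c' y]
      by (simp add: higher_pderiv_add)
    show "poly (p0 + smult c ([:-x, 1:] ^ d)) z = poly (q0 + smult c' ([:-y, 1:] ^ e)) z"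
      using c(1) by (simp add: poly_power)
    show "poly (pderiv (p0 + smult c ([:-x, 1:] ^ d))) z =
      poly (pderiv (q0 + smult c' ([:-y, 1:] ^ e))) z"
      using c(2) by (simp add: pderiv_add pderiv_smult poly_pderiv_shifted_power)
  qed
  then show ?thesis
    using that by blast
qed

text \<open>The differences of two solutions solve the homogeneous problem, so they are shifted
  powers whose factors lie in the trivial kernel.\<close>

lemma hermite_pair_unique:
  assumes "x < z" "z < y" "d \<ge> 1" "e \<ge> 1"
    and pq: "hermite_pair d e x z y g g' p q" and pq': "hermite_pair d e x z y g g' p' q'"
  shows "p' = p \<and> q' = q"
proof -
  have "degree (p' - p) \<le> d" "degree (q' - q) \<le> e"
    using pq pq' by (auto simp: hermite_pair_def intro: degree_diff_le)
  moreover have "poly ((pderiv ^^ j) (p' - p)) x = 0" if "j < d" for j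
    using pq pq' that by (simp add: hermite_pair_def higher_pderiv_diff)
  moreover have "poly ((pderiv ^^ j) (q' - q)) y = 0" if "j < e" for j
    using pq pq' that by (simp add: hermite_pair_def higher_pderiv_diff)
  ultimately obtain c c' where c: "p' - p = smult c ([:-x, 1:] ^ d)"
    and c': "q' - q = smult c' ([:-y, 1:] ^ e)"
    by (meson vanishing_derivatives_imp_monomial)
  have "poly (p' - p) z = poly (q' - q) z"
    using pq pq' by (simp add: hermite_pair_def)
  then have 1: "c * (z - x) ^ d = c' * (-(y - z)) ^ e"
    unfolding c c' by (simp add: poly_power)
  have "poly (pderiv (p' - p)) z = poly (pderiv (q' - q)) z"
    using pq pq' by (simp add: hermite_pair_def pderiv_diff)
  then have 2: "c * (real d * (z - x) ^ (d - 1)) = c' * (real e * (-(y - z)) ^ (e - 1))"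
    unfolding c c' by (simp add: pderiv_smult poly_pderiv_shifted_power)
  have "c = 0 \<and> c' = 0"
    using split_system_trivial_kernel[OF _ _ _ _ 1 2] assms by simp
  then show ?thesis
    using c c' by simp
qed

subsection \<open>Derivatives of a piecewise polynomial\<close>

lemma has_real_derivative_join:
  fixes p q :: "real poly"
  assumes "poly p x = poly q x" "poly (pderiv p) x = poly (pderiv q) x"
  shows "((\<lambda>t. if t \<le> x then poly p t else poly q t) has_real_derivative
    (if y \<le> x then poly (pderiv p) y else poly (pderiv q) y)) (at y)"
    (is "(?f has_real_derivative _) _")
proof -
  have D: "(poly r has_real_derivative poly (pderiv r) y) (at y within S)" for r S
    using poly_DERIV has_field_derivative_at_within by blast
  consider "y < x" | "y = x" | "y > x"
    by linarith
  then show ?thesis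
  proof cases
    case 1
    have "(?f has_real_derivative poly (pderiv p) y) (at y)"
      by (rule has_field_derivative_transform_within[OF D[of p], where d = "x - y"])
        (use 1 in \<open>auto simp: dist_real_def\<close>)
    then show ?thesis
      using 1 by simp
  next
    case 2
    \<comment> \<open>At the join each side is handled by its own polynomial; the one-sided
      derivatives coincide by assumption and combine to a two-sided one.\<close>
    have "(?f has_real_derivative poly (pderiv p) y) (at y within {..x})"
      by (rule has_field_derivative_transform_within[OF D[of p], where d = 1]) (use 2 in auto)
    moreover have "(?f has_real_derivative poly (pderiv p) y) (at y within {x..})"
    proof (rule has_field_derivative_transform_within[where d = 1])
      show "(poly q has_real_derivative poly (pderiv p) y) (at y within {x..})"
        using D[of q "{x..}"] assms(2) 2 by simp
    qed (use assms(1) 2 in auto)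
    ultimately have "(?f has_real_derivative poly (pderiv p) y) (at y within {..x} \<union> {x..})"
      unfolding has_field_derivative_iff Lim_within_Un by blast
    moreover have "{..x} \<union> {x..} = UNIV"
      by auto
    ultimately show ?thesis
      using 2 by simp
  next
    case 3
    have "(?f has_real_derivative poly (pderiv q) y) (at y)"
      by (rule has_field_derivative_transform_within[OF D[of q], where d = "y - x"])
        (use 3 in \<open>auto simp: dist_real_def\<close>)
    then show ?thesis
      using 3 by simp
  qed
qed

text \<open>Passes from iterated derivatives of \<open>s\<close> to formal derivatives of its
  pieces. The formula is proved on all of the open window between \<open>l\<close> and
  \<open>u\<close>, because order \<open>Suc j\<close> at a point needs order \<open>j\<close>
  nearby. The window may reach beyond \<open>{a..b}\<close>, which covers the end knots.\<close>

lemma deriv_within_join: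
  fixes p q :: "real poly"
  assumes "a < b"
    and "\<And>y. y \<in> {a..b} \<Longrightarrow> l < y \<Longrightarrow> y \<le> x \<Longrightarrow> s y = poly p y"
    and "\<And>y. y \<in> {a..b} \<Longrightarrow> x \<le> y \<Longrightarrow> y < u \<Longrightarrow> s y = poly q y"
    and agree: "\<And>k. k \<le> r \<Longrightarrow> poly ((pderiv ^^ k) p) x = poly ((pderiv ^^ k) q) x"
    and "j \<le> r" "y \<in> {a..b}" "l < y" "y < u"
  shows "deriv_within {a..b} j s y =
    (if y \<le> x then poly ((pderiv ^^ j) p) y else poly ((pderiv ^^ j) q) y)"
  using \<open>j \<le> r\<close> \<open>y \<in> {a..b}\<close> \<open>l < y\<close> \<open>y < u\<close>
proof (induction j arbitrary: y)
  case 0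
  then show ?case
    using assms(2,3)[of y] by auto
next
  case (Suc j)
  let ?f = "\<lambda>t. if t \<le> x then poly ((pderiv ^^ j) p) t else poly ((pderiv ^^ j) q) t"
  let ?D = "if y \<le> x then poly ((pderiv ^^ Suc j) p) y else poly ((pderiv ^^ Suc j) q) y"
  have "(?f has_real_derivative ?D) (at y)"
    using has_real_derivative_join[of "(pderiv ^^ j) p" x "(pderiv ^^ j) q" y]
      agree[of j] agree[of "Suc j"] Suc.prems unfolding funpow.simps(2) comp_apply by simp
  then have "(?f has_real_derivative ?D) (at y within {a..b})"
    by (rule has_field_derivative_at_within)
  then have "(deriv_within {a..b} j s has_real_derivative ?D) (at y within {a..b})"
  \<comment> \<open>This radius keeps the nearby points inside the window, where the induction
    hypothesis applies.\<close>
  proof (rule has_field_derivative_transform_within[where d = "min (y - l) (u - y)"])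
    show "?f t = deriv_within {a..b} j s t" if "t \<in> {a..b}" "dist t y < min (y - l) (u - y)" for t
      using Suc.IH[of t] Suc.prems that by (simp add: dist_real_def abs_less_iff)
  qed (use Suc.prems in auto)
  then have "(deriv_within {a..b} j s has_vector_derivative ?D) (at y within {a..b})"
    by (simp add: has_real_derivative_iff_has_vector_derivative)
  \<comment> \<open>Since the interval is non-degenerate, derivatives within it are unique, also at
    its end points.\<close>
  moreover have "at y within {a..b} \<noteq> bot"
    using Suc.prems \<open>a < b\<close> by (simp add: trivial_limit_within)
  ultimately show ?case
    by (simp add: vector_derivative_within)
qed

subsection \<open>Splines on a refined partition\<close>

text \<open>Induction on the number of intervals. The value at the last knot is carried along so
  that the next piece can be attached there consistently.\<close>

lemma glue_pieces:
  fixes v \<zeta> :: "nat \<Rightarrow> real" and P Q :: "nat \<Rightarrow> real \<Rightarrow> real" and g :: "nat \<Rightarrow> real"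
  assumes "\<And>i. i < m \<Longrightarrow> v i < \<zeta> i" "\<And>i. i < m \<Longrightarrow> \<zeta> i < v (Suc i)"
    and "\<And>i. i < m \<Longrightarrow> P i (v i) = g i" "\<And>i. i < m \<Longrightarrow> Q i (v (Suc i)) = g (Suc i)"
    and "\<And>i. i < m \<Longrightarrow> P i (\<zeta> i) = Q i (\<zeta> i)"
  shows "\<exists>s. s (v m) = g m \<and>
    (\<forall>i<m. (\<forall>y\<in>{v i..\<zeta> i}. s y = P i y) \<and> (\<forall>y\<in>{\<zeta> i..v (Suc i)}. s y = Q i y))"
  using assms
proof (induction m)
  case 0
  show ?case
    by (intro exI[of _ "\<lambda>_. g 0"]) simp
next
  case (Suc m)
  then obtain s where s: "s (v m) = g m"
    "\<forall>i<m. (\<forall>y\<in>{v i..\<zeta> i}. s y = P i y) \<and> (\<forall>y\<in>{\<zeta> i..v (Suc i)}. s y = Q i y)"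
    by auto
  have le: "v i \<le> v j" if "i \<le> j" "j \<le> m" for i j
    using that
  proof (induction j rule: dec_induct)
    case (step k)
    then show ?case
      using Suc.prems(1,2)[of k] by simp
  qed simp
  \<comment> \<open>Nothing changes up to \<open>v m\<close>, and by monotonicity all earlier
    intervals lie there.\<close>
  define s' where "s' y = (if y \<le> v m then s y else if y \<le> \<zeta> m then P m y else Q m y)" for y
  have m: "v m < \<zeta> m" "\<zeta> m < v (Suc m)" "P m (v m) = g m" "P m (\<zeta> m) = Q m (\<zeta> m)"
      "Q m (v (Suc m)) = g (Suc m)"
    using Suc.prems by auto
  have "(\<forall>y\<in>{v i..\<zeta> i}. s' y = P i y) \<and> (\<forall>y\<in>{\<zeta> i..v (Suc i)}. s' y = Q i y)" if "i < Suc m" for i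
  proof (cases "i = m")
    case True
    then show ?thesis
      using m s(1) by (auto simp: s'_def antisym)
  next
    case False
    then have "\<zeta> i < v (Suc i)" "v (Suc i) \<le> v m" "i < m"
      using that Suc.prems(2)[of i] le[of "Suc i" m] by auto
    then show ?thesis
      using s(2) by (auto simp: s'_def)
  qed
  moreover have "s' (v (Suc m)) = g (Suc m)"
    using m by (simp add: s'_def)
  ultimately show ?case
    by blast
qed

locale refined_partition =
  fixes n :: nat and v \<zeta> :: "nat \<Rightarrow> real"
  assumes n: "n \<ge> 1"
    and split: "\<And>i. i < n \<Longrightarrow> v i < \<zeta> i" "\<And>i. i < n \<Longrightarrow> \<zeta> i < v (Suc i)"
begin

lemma knot_mono: "i \<le> j \<Longrightarrow> j \<le> n \<Longrightarrow> v i \<le> v j"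
proof (induction j rule: dec_induct)
  case (step k)
  then show ?case
    using split[of k] by simp
qed simp

lemma knot_mem: "i \<le> n \<Longrightarrow> v i \<in> {v 0..v n}"
  using knot_mono by simp

lemma ends_less: "v 0 < v n"
  using split[of 0] knot_mono[of 1 n] n by simp

lemma split_right_eq: "i < n \<Longrightarrow> split_right n v \<zeta> i = \<zeta> i"
  by (simp add: split_right_def)

lemma split_left_eq: "split_left v \<zeta> (Suc i) = \<zeta> i"
  by (simp add: split_left_def)

lemma interval_cover:
  assumes "y \<in> {v 0..v n}"
  obtains i where "i < n" "y \<in> {v i..\<zeta> i} \<or> y \<in> {\<zeta> i..v (Suc i)}"
proof -
  \<comment> \<open>The first interval whose right knot is not left of \<open>y\<close>; minimality
    puts its left knot below \<open>y\<close> unless \<open>i = 0\<close>.\<close>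
  define i where "i = (LEAST i. y \<le> v (Suc i))"
  have ex: "y \<le> v (Suc (n - 1))"
    using assms n by simp
  then have "y \<le> v (Suc i)"
    unfolding i_def by (rule LeastI)
  moreover have "i \<le> n - 1"
    unfolding i_def using ex by (rule Least_le)
  then have "i < n"
    using n by simp
  moreover have "v i \<le> y"
  proof (cases i)
    case 0
    then show ?thesis
      using assms by simp
  next
    case (Suc j)
    then have "\<not> y \<le> v (Suc j)"
      unfolding i_def by (metis lessI not_less_Least)
    then show ?thesis
      using Suc by simp
  qed
  ultimately show ?thesis
    using that[of i] by (meson atLeastAtMost_iff linear)
qed

lemma deriv_within_left_piece:
  assumes s: "s \<in> spline_space n v \<zeta> \<phi>" and "i < n" and "j \<le> \<phi> i - 1"
    and p: "\<And>y. y \<in> {v i..\<zeta> i} \<Longrightarrow> s y = poly p y"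
  shows "deriv_within {v 0..v n} j s (v i) = poly ((pderiv ^^ j) p) (v i)"
proof (cases i)
  case 0
  \<comment> \<open>At the first knot \<open>p\<close> serves as both pieces: with \<open>l\<close>
    below \<open>v 0\<close>, the left condition concerns the single point
    \<open>v 0\<close>.\<close>
  then have "deriv_within {v 0..v n} j s (v 0) =
      (if v 0 \<le> v 0 then poly ((pderiv ^^ j) p) (v 0) else poly ((pderiv ^^ j) p) (v 0))"
    using ends_less p split[OF \<open>i < n\<close>]
    by (intro deriv_within_join[where l = "v 0 - 1" and u = "\<zeta> 0" and r = j]) auto
  then show ?thesis
    using 0 by simp
next
  case (Suc k)
  then have "pieces_agree (\<phi> i - 1) (\<zeta> k) (v i) (\<zeta> i) s"
    using s \<open>i < n\<close> split_right_eq[of i] split_left_eq[of k] by (auto simp: spline_space_def)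
  then obtain p' q' where pq: "\<And>y. y \<in> {\<zeta> k..v i} \<Longrightarrow> s y = poly p' y"
      "\<And>y. y \<in> {v i..\<zeta> i} \<Longrightarrow> s y = poly q' y"
      "\<And>m. m \<le> \<phi> i - 1 \<Longrightarrow> poly ((pderiv ^^ m) p') (v i) = poly ((pderiv ^^ m) q') (v i)"
    by (auto simp: pieces_agree_def)
  have "q' = p"
    using split(1)[OF \<open>i < n\<close>] p pq(2) by (intro poly_eq_if_eq_on_interval) auto
  have "deriv_within {v 0..v n} j s (v i) =
      (if v i \<le> v i then poly ((pderiv ^^ j) p') (v i) else poly ((pderiv ^^ j) q') (v i))"
    using ends_less pq split(1)[OF \<open>i < n\<close>] split(2)[of k] Suc \<open>i < n\<close> \<open>j \<le> \<phi> i - 1\<close> knot_mem[of i]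
    by (intro deriv_within_join[where l = "\<zeta> k" and u = "\<zeta> i" and r = "\<phi> i - 1"]) auto
  then show ?thesis
    using pq(3) \<open>j \<le> \<phi> i - 1\<close> \<open>q' = p\<close> by simp
qed

lemma deriv_within_right_piece:
  assumes s: "s \<in> spline_space n v \<zeta> \<phi>" and "i < n" and "j \<le> \<phi> (Suc i) - 1"
    and q: "\<And>y. y \<in> {\<zeta> i..v (Suc i)} \<Longrightarrow> s y = poly q y"
  shows "deriv_within {v 0..v n} j s (v (Suc i)) = poly ((pderiv ^^ j) q) (v (Suc i))"
proof (cases "Suc i = n")
  case True
  then have "deriv_within {v 0..v n} j s (v n) =
      (if v n \<le> v n then poly ((pderiv ^^ j) q) (v n) else poly ((pderiv ^^ j) q) (v n))"
    using ends_less q split[OF \<open>i < n\<close>]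
    by (intro deriv_within_join[where l = "\<zeta> i" and u = "v n + 1" and r = j]) auto
  then show ?thesis
    using True by simp
next
  case False
  then have "Suc i < n"
    using \<open>i < n\<close> by simp
  then have "pieces_agree (\<phi> (Suc i) - 1) (\<zeta> i) (v (Suc i)) (\<zeta> (Suc i)) s"
    using s split_right_eq[of "Suc i"] split_left_eq[of i] by (auto simp: spline_space_def)
  then obtain p' q' where pq: "\<And>y. y \<in> {\<zeta> i..v (Suc i)} \<Longrightarrow> s y = poly p' y"
      "\<And>y. y \<in> {v (Suc i)..\<zeta> (Suc i)} \<Longrightarrow> s y = poly q' y"
      "\<And>m. m \<le> \<phi> (Suc i) - 1 \<Longrightarrow>
         poly ((pderiv ^^ m) p') (v (Suc i)) = poly ((pderiv ^^ m) q') (v (Suc i))"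
    by (auto simp: pieces_agree_def)
  have "p' = q"
    using split(2)[OF \<open>i < n\<close>] q pq(1) by (intro poly_eq_if_eq_on_interval) auto
  have "deriv_within {v 0..v n} j s (v (Suc i)) =
      (if v (Suc i) \<le> v (Suc i) then poly ((pderiv ^^ j) p') (v (Suc i))
       else poly ((pderiv ^^ j) q') (v (Suc i)))"
    using ends_less pq split(2)[OF \<open>i < n\<close>] split(1)[OF \<open>Suc i < n\<close>]
      \<open>Suc i < n\<close> \<open>j \<le> \<phi> (Suc i) - 1\<close> knot_mem[of "Suc i"]
    by (intro deriv_within_join[where l = "\<zeta> i" and u = "\<zeta> (Suc i)" and r = "\<phi> (Suc i) - 1"]) auto
  then show ?thesis
    using \<open>p' = q\<close> by simp
qed

text \<open>Reduces the spline problem to prescribed pieces. Forwards, the pieces of a spline solve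
  the local problems, whose solutions are unique; backwards, pieces meeting at a knot share the data
  there.\<close>

lemma interpolating_spline_iff:
  fixes P Q :: "nat \<Rightarrow> real poly"
  assumes \<phi>: "\<And>i. i \<le> n \<Longrightarrow> \<phi> i \<ge> 1"
    and PQ: "\<And>i. i < n \<Longrightarrow>
      hermite_pair (\<phi> i) (\<phi> (Suc i)) (v i) (\<zeta> i) (v (Suc i)) (f i) (f (Suc i)) (P i) (Q i)"
  shows "s \<in> spline_space n v \<zeta> \<phi> \<and>
      (\<forall>i\<le>n. \<forall>j\<le>\<phi> i - 1. deriv_within {v 0..v n} j s (v i) = f i j) \<longleftrightarrow>
    s \<in> extensional {v 0..v n} \<and>
      (\<forall>i<n. (\<forall>y\<in>{v i..\<zeta> i}. s y = poly (P i) y) \<and> (\<forall>y\<in>{\<zeta> i..v (Suc i)}. s y = poly (Q i) y))"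
    (is "?L \<longleftrightarrow> ?R")
proof
  assume L: ?L
  then have s: "s \<in> spline_space n v \<zeta> \<phi>"
    by simp
  have "(\<forall>y\<in>{v i..\<zeta> i}. s y = poly (P i) y) \<and> (\<forall>y\<in>{\<zeta> i..v (Suc i)}. s y = poly (Q i) y)"
    if "i < n" for i
  proof -
    have "poly_on (\<phi> i) {v i..\<zeta> i} s" "poly_on (\<phi> (Suc i)) {\<zeta> i..v (Suc i)} s"
      using s that split[OF that] split_right_eq[OF that] split_left_eq[of i]
      by (auto simp: spline_space_def dest: spec[of _ i] spec[of _ "Suc i"])
    then obtain p q where p: "degree p \<le> \<phi> i" "\<And>y. y \<in> {v i..\<zeta> i} \<Longrightarrow> s y = poly p y"
      and q: "degree q \<le> \<phi> (Suc i)" "\<And>y. y \<in> {\<zeta> i..v (Suc i)} \<Longrightarrow> s y = poly q y"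
      unfolding poly_on_def by blast
    have "pieces_agree 1 (v i) (\<zeta> i) (v (Suc i)) s"
      using s that by (simp add: spline_space_def)
    then obtain p' q' where pq: "\<And>y. y \<in> {v i..\<zeta> i} \<Longrightarrow> s y = poly p' y"
      "\<And>y. y \<in> {\<zeta> i..v (Suc i)} \<Longrightarrow> s y = poly q' y"
      "\<And>m. m \<le> 1 \<Longrightarrow> poly ((pderiv ^^ m) p') (\<zeta> i) = poly ((pderiv ^^ m) q') (\<zeta> i)"
      by (auto simp: pieces_agree_def)
    \<comment> \<open>The degree bound is known for \<open>p\<close> and \<open>q\<close>, the
      smoothness for \<open>p'\<close> and \<open>q'\<close>; identifying them yields both for one
      pair.\<close>
    have "p' = p"
      using split(1)[OF that] p(2) pq(1) by (intro poly_eq_if_eq_on_interval) auto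
    moreover have "q' = q"
      using split(2)[OF that] q(2) pq(2) by (intro poly_eq_if_eq_on_interval) auto
    ultimately have "poly p (\<zeta> i) = poly q (\<zeta> i)" "poly (pderiv p) (\<zeta> i) = poly (pderiv q) (\<zeta> i)"
      using pq(3)[of 0] pq(3)[of 1] by simp_all
    moreover have "poly ((pderiv ^^ j) p) (v i) = f i j" if "j < \<phi> i" for j
      using deriv_within_left_piece[OF s \<open>i < n\<close>, of j p] p(2) L that \<open>i < n\<close> by simp
    moreover have "poly ((pderiv ^^ j) q) (v (Suc i)) = f (Suc i) j" if "j < \<phi> (Suc i)" for j
      using deriv_within_right_piece[OF s \<open>i < n\<close>, of j q] q(2) L that \<open>i < n\<close> by simp
    ultimately have "hermite_pair (\<phi> i) (\<phi> (Suc i)) (v i) (\<zeta> i) (v (Suc i)) (f i) (f (Suc i)) p q"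
      using p(1) q(1) by (simp add: hermite_pair_def)
    then have "p = P i \<and> q = Q i"
      using hermite_pair_unique[OF split[OF that] _ _ PQ[OF that]] \<phi> that by simp
    then show ?thesis
      using p(2) q(2) by simp
  qed
  then show ?R
    using s by (simp add: spline_space_def)
next
  assume R: ?R
  then have P: "\<And>i y. i < n \<Longrightarrow> y \<in> {v i..\<zeta> i} \<Longrightarrow> s y = poly (P i) y"
    and Q: "\<And>i y. i < n \<Longrightarrow> y \<in> {\<zeta> i..v (Suc i)} \<Longrightarrow> s y = poly (Q i) y"
    by auto
  \<comment> \<open>As \<open>\<phi> i \<ge> 1\<close>, the subtraction is not truncated, so
    \<open>j \<le> \<phi> i - 1\<close> means \<open>j < \<phi> i\<close>.\<close>
  have dP: "poly ((pderiv ^^ j) (P i)) (v i) = f i j" if "i < n" "j \<le> \<phi> i - 1" for i j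
    using PQ[OF that(1)] that \<phi>[of i] by (auto simp: hermite_pair_def)
  have dQ: "poly ((pderiv ^^ j) (Q i)) (v (Suc i)) = f (Suc i) j"
    if "i < n" "j \<le> \<phi> (Suc i) - 1" for i j
    using PQ[OF that(1)] that \<phi>[of "Suc i"] by (auto simp: hermite_pair_def)
  have s: "s \<in> spline_space n v \<zeta> \<phi>"
    unfolding spline_space_def
  proof (intro CollectI conjI allI impI)
    show "s \<in> extensional {v 0..v n}"
      using R by simp
  next
    fix i assume "i \<le> n" "split_left v \<zeta> i < v i"
    then obtain k where "i = Suc k"
      by (cases i) (auto simp: split_left_def)
    then show "poly_on (\<phi> i) {split_left v \<zeta> i..v i} s"
      using PQ[of k] Q[of k] \<open>i \<le> n\<close> by (auto simp: poly_on_def hermite_pair_def split_left_eq)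
  next
    fix i assume "i \<le> n" "v i < split_right n v \<zeta> i"
    then have "i < n"
      by (cases "i = n") (auto simp: split_right_def)
    then show "poly_on (\<phi> i) {v i..split_right n v \<zeta> i} s"
      using PQ[of i] P[of i] by (auto simp: poly_on_def hermite_pair_def split_right_eq)
  next
    fix i assume i: "0 < i \<and> i < n"
    then obtain k where k: "i = Suc k"
      by (cases i) auto
    \<comment> \<open>Smoothness at an interior knot: the derivatives of both neighbouring pieces
      equal \<open>f i m\<close> there.\<close>
    have "(\<forall>y\<in>{split_left v \<zeta> i..v i}. s y = poly (Q k) y) \<and>
        (\<forall>y\<in>{v i..split_right n v \<zeta> i}. s y = poly (P i) y) \<and>
        (\<forall>m\<le>\<phi> i - 1. poly ((pderiv ^^ m) (Q k)) (v i) = poly ((pderiv ^^ m) (P i)) (v i))"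
      using i k P[of i] Q[of k] dP[of i] dQ[of k] by (simp add: split_left_eq split_right_eq)
    then show "pieces_agree (\<phi> i - 1) (split_left v \<zeta> i) (v i) (split_right n v \<zeta> i) s"
      unfolding pieces_agree_def by blast
  next
    fix i assume i: "i < n"
    have "\<forall>m\<le>1. poly ((pderiv ^^ m) (P i)) (\<zeta> i) = poly ((pderiv ^^ m) (Q i)) (\<zeta> i)"
      using PQ[OF i] by (auto simp: hermite_pair_def le_Suc_eq)
    then show "pieces_agree 1 (v i) (\<zeta> i) (v (Suc i)) s"
      unfolding pieces_agree_def using P[OF i] Q[OF i] by blast
  qed
  moreover have "deriv_within {v 0..v n} j s (v i) = f i j" if "i \<le> n" "j \<le> \<phi> i - 1" for i j
  proof (cases "i < n")
    case True
    then show ?thesis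
      using deriv_within_left_piece[OF s True, of j "P i"] P dP that by simp
  next
    case False
    then have "0 < i" "i \<le> n"
      using that n by simp_all
    then obtain k where "i = Suc k" "k < n"
      by (cases i) simp_all
    then show ?thesis
      using deriv_within_right_piece[OF s \<open>k < n\<close>, of j "Q k"] Q dQ that by simp
  qed
  ultimately show ?L
    by blast
qed

end

theorem theorem4:
  fixes n :: nat and a b :: real and v \<zeta> :: "nat \<Rightarrow> real"
    and \<phi> :: "nat \<Rightarrow> nat" and f :: "nat \<Rightarrow> nat \<Rightarrow> real"
  assumes "n \<ge> 1"
    and "a = v 0" and "v n = b"
    and "\<And>i. i < n \<Longrightarrow> v i < v (Suc i)"
    and "\<And>i. i < n \<Longrightarrow> \<zeta> i \<in> {v i<..<v (Suc i)}"
    and "\<And>i. i \<le> n \<Longrightarrow> \<phi> i \<ge> 1"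
  shows "\<exists>!s. s \<in> spline_space n v \<zeta> \<phi> \<and>
           (\<forall>i\<le>n. \<forall>j\<le>\<phi> i - 1. deriv_within {a..b} j s (v i) = f i j)"
proof -
  interpret refined_partition n v \<zeta>
    using assms(1,5) by unfold_locales simp_all
  have "\<exists>p q. hermite_pair (\<phi> i) (\<phi> (Suc i)) (v i) (\<zeta> i) (v (Suc i)) (f i) (f (Suc i)) p q"
    if "i < n" for i
    by (rule hermite_pair_exists[OF split[OF that] assms(6)[of i] assms(6)[of "Suc i"]])
      (use that in auto)
  then obtain P Q where PQ: "\<And>i. i < n \<Longrightarrow>
      hermite_pair (\<phi> i) (\<phi> (Suc i)) (v i) (\<zeta> i) (v (Suc i)) (f i) (f (Suc i)) (P i) (Q i)"
    by metis
  \<comment> \<open>Gluing needs continuity only. The common knot value is the order 0 datum, which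
    is prescribed because \<open>\<phi> i \<ge> 1\<close>.\<close>
  have g: "poly (P i) (v i) = f i 0" "poly (Q i) (v (Suc i)) = f (Suc i) 0"
      "poly (P i) (\<zeta> i) = poly (Q i) (\<zeta> i)" if "i < n" for i
    using PQ[OF that] that assms(6)[of i] assms(6)[of "Suc i"]
    by (auto simp: hermite_pair_def dest!: spec[of _ 0])
  have "\<exists>s. s (v n) = f n 0 \<and> (\<forall>i<n. (\<forall>y\<in>{v i..\<zeta> i}. s y = poly (P i) y) \<and>
      (\<forall>y\<in>{\<zeta> i..v (Suc i)}. s y = poly (Q i) y))"
    by (rule glue_pieces) (use split g in auto)
  then obtain s where "\<forall>i<n. (\<forall>y\<in>{v i..\<zeta> i}. s y = poly (P i) y) \<and>
      (\<forall>y\<in>{\<zeta> i..v (Suc i)}. s y = poly (Q i) y)"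
    by blast
  then have s: "\<And>i y. i < n \<Longrightarrow> y \<in> {v i..\<zeta> i} \<Longrightarrow> s y = poly (P i) y"
      "\<And>i y. i < n \<Longrightarrow> y \<in> {\<zeta> i..v (Suc i)} \<Longrightarrow> s y = poly (Q i) y"
    by blast+
  have mem: "{v i..\<zeta> i} \<subseteq> {v 0..v n}" "{\<zeta> i..v (Suc i)} \<subseteq> {v 0..v n}" if "i < n" for i
    using that split[OF that] knot_mem[of i] knot_mem[of "Suc i"] by auto
  \<comment> \<open>The pieces cover \<open>{v 0..v n}\<close> and extensionality fixes the values
    outside, so restricting the glued function gives the only candidate.\<close>
  have "\<exists>!s. s \<in> extensional {v 0..v n} \<and>
      (\<forall>i<n. (\<forall>y\<in>{v i..\<zeta> i}. s y = poly (P i) y) \<and> (\<forall>y\<in>{\<zeta> i..v (Suc i)}. s y = poly (Q i) y))"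
  proof (rule ex1I[of _ "restrict s {v 0..v n}"])
    show "restrict s {v 0..v n} \<in> extensional {v 0..v n} \<and>
      (\<forall>i<n. (\<forall>y\<in>{v i..\<zeta> i}. restrict s {v 0..v n} y = poly (P i) y) \<and>
        (\<forall>y\<in>{\<zeta> i..v (Suc i)}. restrict s {v 0..v n} y = poly (Q i) y))"
      using s mem by (auto simp: subset_iff)
  next
    fix t assume t: "t \<in> extensional {v 0..v n} \<and>
      (\<forall>i<n. (\<forall>y\<in>{v i..\<zeta> i}. t y = poly (P i) y) \<and> (\<forall>y\<in>{\<zeta> i..v (Suc i)}. t y = poly (Q i) y))"
    have "t y = s y" if y: "y \<in> {v 0..v n}" for y
    proof -
      obtain i where "i < n" "y \<in> {v i..\<zeta> i} \<or> y \<in> {\<zeta> i..v (Suc i)}"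
        using interval_cover[OF y] .
      then show ?thesis
        using s t by metis
    qed
    then show "t = restrict s {v 0..v n}"
      using t by (intro extensionalityI[of _ "{v 0..v n}"]) auto
  qed
  moreover have "s \<in> spline_space n v \<zeta> \<phi> \<and>
      (\<forall>i\<le>n. \<forall>j\<le>\<phi> i - 1. deriv_within {a..b} j s (v i) = f i j) \<longleftrightarrow>
    s \<in> extensional {v 0..v n} \<and>
      (\<forall>i<n. (\<forall>y\<in>{v i..\<zeta> i}. s y = poly (P i) y) \<and> (\<forall>y\<in>{\<zeta> i..v (Suc i)}. s y = poly (Q i) y))" for s
    unfolding assms(2) assms(3)[symmetric]
    by (rule interpolating_spline_iff) (use assms(6) PQ in auto)
  ultimately show ?thesis
    by presburger
qed

end
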